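(* Let $$P_k=\lim_{n\to\infty}\mathbb{P}\big[\mathbf{C}_{n,p}\text{ contains a run of }k\text{ equal nonzero terms}\big].$$ Then, for any fixed integer $k\ge2$ and any positive constant $\alpha$, $$P_k=\begin{cases}0,&\text{if } p\ll n^{-1/k},\\ 1-e^{-\alpha^k},&\text{if } p\sim\alpha n^{-1/k},\\ 1,&\text{if } n^{-1/k}\ll p\text{ and } q\gg n^{-1/(k-1)},\\ 1-e^{-\alpha^{k-1}/k},&\text{if } q\sim\alpha n^{-1/(k-1)},\\ 0,&\text{if } n^{-1/(k-1)}\gg q.\end{cases}$$
   Context: An $n$-composition is a sequence of $n$ nonnegative integers. For $p=p(n)\in[0,1)$ and $q=1-p$, the geometric random composition $\mathbf{C}_{n,p}$ is the random $n$-composition whose terms are independent, with $\mathbb{P}[\mathbf{C}_{n,p}(i)=j]=qp^j$ for every $j\ge0$ and $i\in\{1,\dots,n\}$. A composition contains a run of $k$ equal nonzero terms if there are $k$ consecutive terms all equal to the same positive integer (the run need not be maximal). For positive functions of $n$: $f\ll g$ (or $g\gg f$) means $\lim_{n\to\infty} f/g=0$, and $f\sim g$ means $\lim_{n\to\infty} f/g=1$. *)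

theory Defs
  imports "HOL-Probability.Probability" "HOL-Library.Landau_Symbols"
begin

text \<open>
  An \<open>n\<close>-composition is represented by its term function on the positions \<open>{1..n}\<close>; outside of
  these positions the function has the dummy value \<open>0\<close>. The library's \<open>geometric_pmf\<close> takes the
  success probability, here \<open>q = 1 - p\<close>, and counts failures, so it has support starting at \<open>0\<close>.
\<close>

definition geometric_composition :: "nat \<Rightarrow> real \<Rightarrow> (nat \<Rightarrow> nat) pmf" where
  "geometric_composition n p = Pi_pmf {1..n} 0 (\<lambda>_. geometric_pmf (1 - p))"

lemma pmf_geometric_composition_term:
  assumes "0 \<le> p" "p < 1" "i \<in> {1..n}"
  shows "pmf (map_pmf (\<lambda>C. C i) (geometric_composition n p)) j = (1 - p) * p ^ j"
proof -
  have "map_pmf (\<lambda>C. C i) (geometric_composition n p) = geometric_pmf (1 - p)"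
    unfolding geometric_composition_def using assms(3) by (subst Pi_pmf_component) auto
  with assms(1,2) show ?thesis by simp
qed

lemma indep_vars_geometric_composition:
  "prob_space.indep_vars (measure_pmf (geometric_composition n p))
     (\<lambda>_. count_space UNIV) (\<lambda>i C. C i) {1..n}"
  unfolding geometric_composition_def by (rule indep_vars_Pi_pmf) simp

text \<open>The run occupies the positions \<open>i, \<dots>, i + k - 1\<close> and need not be maximal.\<close>

definition has_nonzero_run :: "nat \<Rightarrow> nat \<Rightarrow> (nat \<Rightarrow> nat) \<Rightarrow> bool" where
  "has_nonzero_run n k C \<longleftrightarrow>
     (\<exists>i j. {i..<i + k} \<subseteq> {1..n} \<and> j > 0 \<and> (\<forall>m\<in>{i..<i + k}. C m = j))"

definition run_prob :: "nat \<Rightarrow> nat \<Rightarrow> real \<Rightarrow> real" where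
  "run_prob k n p = measure_pmf.prob (geometric_composition n p) {C. has_nonzero_run n k C}"

end

theory Submission
  imports Defs
begin

text \<open>
  Let \<open>s\<close> be the probability that \<open>k\<close> given consecutive positions carry a common nonzero term, and
  \<open>e\<close> the same for \<open>k + 1\<close> positions. About \<open>n s\<close> windows of length \<open>k\<close> are expected to be runs.
  Overlapping windows that are both runs must carry the same value, so runs clump only through
  runs of length \<open>k + 1\<close>; where \<open>n s\<close> has a finite limit, those are too rare to matter
  (\<open>n e \<longlonglongrightarrow> 0\<close>), and the number of runs behaves like a Poisson variable of mean \<open>lim n s\<close>.

  Instead of moments, the proof uses a recursion for the probability \<open>u n\<close> that the first \<open>n\<close>
  terms contain no run. If the first run is completed at position \<open>m + k\<close>, then the
  window \<open>{m + 1..m + k}\<close> is a run and the first \<open>m\<close> terms have none; conversely, these two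
  independent events make position \<open>m + k\<close> the first one to complete a run, except possibly when
  the term at position \<open>m\<close> also equals those of the window. Hence, for \<open>m > 0\<close>,
  \<open>s * u m - e \<le> u (m + k - 1) - u (m + k) \<le> s * u m\<close>. As \<open>u\<close> varies by at most \<open>k s\<close> over \<open>k\<close> steps, \<open>u n\<close> lies between
  \<open>(1 - s) ^ n - n k s\<^sup>2\<close> and \<open>(1 - s) ^ (n - k) + n e\<close>, and both tend to \<open>exp (- lim n s)\<close>
  (\<open>delayed_decay_tendsto_exp\<close>). When \<open>n s\<close> diverges, the independent disjoint blocks of length
  \<open>k\<close> already give \<open>u n \<le> (1 - s) ^ (n div k) \<longlonglongrightarrow> 0\<close> (\<open>delayed_decay_tendsto_0\<close>).

  What remains is calculus. Summing over the common value and cancelling \<open>q = 1 - p\<close> gives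
  \<open>s = q ^ (k - 1) * p ^ k / (\<Sum>i<k. p ^ i)\<close> and \<open>e \<le> s * (q * p)\<close>. So \<open>n s\<close> is asymptotic to
  \<open>n * p ^ k\<close> if \<open>p\<close> tends to 0 and to \<open>n * q ^ (k - 1) / k\<close> if \<open>q\<close> tends to 0, and in general it is at
  least a constant times the minimum of \<open>n * p ^ k\<close> and \<open>n * q ^ (k - 1)\<close>.
\<close>

section \<open>Events depending on finitely many coordinates\<close>

text \<open>One implication suffices, since the roles of \<open>f\<close> and \<open>g\<close> can be exchanged.\<close>

definition cylinder_over :: "'a set \<Rightarrow> ('a \<Rightarrow> 'b) set \<Rightarrow> bool" where
  "cylinder_over I E \<longleftrightarrow> (\<forall>f g. (\<forall>i\<in>I. f i = g i) \<longrightarrow> f \<in> E \<longrightarrow> g \<in> E)"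

lemma cylinder_over_iff:
  assumes "cylinder_over I E" "\<And>i. i \<in> I \<Longrightarrow> f i = g i"
  shows "f \<in> E \<longleftrightarrow> g \<in> E"
  using assms(1)[unfolded cylinder_over_def, rule_format, of f g]
    assms(1)[unfolded cylinder_over_def, rule_format, of g f] assms(2) by auto

lemma cylinder_over_Int:
  assumes "cylinder_over I E" "cylinder_over J F"
  shows "cylinder_over (I \<union> J) (E \<inter> F)"
  unfolding cylinder_over_def using cylinder_over_iff[OF assms(1)] cylinder_over_iff[OF assms(2)]
  by (metis IntD1 IntD2 IntI UnI1 UnI2)

text \<open>Marginalisation: it allows events about compositions of different lengths to be
  compared inside one probability space.\<close>

lemma prob_Pi_pmf_cylinder:
  assumes "finite A" "I \<subseteq> A" "cylinder_over I E"
  shows "measure_pmf.prob (Pi_pmf A d D) E = measure_pmf.prob (Pi_pmf I d D) E"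
proof -
  have "(\<lambda>f x. if x \<in> I then f x else d) -` E = E"
    unfolding vimage_def by (intro set_eqI, simp, intro cylinder_over_iff[OF assms(3)]) simp
  then show ?thesis
    by (simp add: Pi_pmf_subset[OF assms(1,2)])
qed

text \<open>On the product over \<open>I \<union> J\<close>, the event \<open>E \<inter> F\<close> is a rectangle in the two blocks of coordinates,
  so its probability factorises.\<close>

lemma prob_Pi_pmf_indep:
  assumes A: "finite A" "I \<subseteq> A" "J \<subseteq> A" and disj: "I \<inter> J = {}"
    and E: "cylinder_over I E" and F: "cylinder_over J F"
  shows "measure_pmf.prob (Pi_pmf A d D) (E \<inter> F) =
         measure_pmf.prob (Pi_pmf A d D) E * measure_pmf.prob (Pi_pmf A d D) F"
proof -
  have fin: "finite I" "finite J" using A finite_subset by auto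
  let ?h = "\<lambda>(f, g) x. if x \<in> I then f x else g x"
  let ?MI = "Pi_pmf I d D" and ?MJ = "Pi_pmf J d D"
  have "measure_pmf.prob (Pi_pmf A d D) (E \<inter> F) = measure_pmf.prob (Pi_pmf (I \<union> J) d D) (E \<inter> F)"
    using A by (intro prob_Pi_pmf_cylinder cylinder_over_Int E F) auto
  also have "\<dots> = measure_pmf.prob (pair_pmf ?MI ?MJ) (?h -` (E \<inter> F))"
    by (simp add: Pi_pmf_union[OF fin disj])
  also have "?h -` (E \<inter> F) = E \<times> F"
  proof -
    have "?h (f, g) \<in> E \<longleftrightarrow> f \<in> E" for f g
      by (rule cylinder_over_iff[OF E]) auto
    moreover have "?h (f, g) \<in> F \<longleftrightarrow> g \<in> F" for f g
      by (rule cylinder_over_iff[OF F]) (use disj in auto)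
    ultimately show ?thesis by auto
  qed
  \<comment> \<open>The rule for probabilities of rectangles asks for countable sides; the supports provide them.\<close>
  also have "measure_pmf.prob (pair_pmf ?MI ?MJ) (E \<times> F) =
      measure_pmf.prob (pair_pmf ?MI ?MJ) ((E \<inter> set_pmf ?MI) \<times> (F \<inter> set_pmf ?MJ))"
    by (intro measure_pmf.finite_measure_eq_AE) (auto simp: AE_measure_pmf_iff)
  also have "\<dots> = measure_pmf.prob ?MI (E \<inter> set_pmf ?MI) * measure_pmf.prob ?MJ (F \<inter> set_pmf ?MJ)"
    by (intro measure_pmf_prob_product) auto
  also have "\<dots> = measure_pmf.prob ?MI E * measure_pmf.prob ?MJ F"
    by (simp add: measure_Int_set_pmf)
  finally show ?thesis
    using A E F by (simp add: prob_Pi_pmf_cylinder)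
qed

section \<open>Windows with a constant nonzero term\<close>

definition constant_nonzero_on :: "nat set \<Rightarrow> (nat \<Rightarrow> nat) set" where
  "constant_nonzero_on W = {C. \<exists>j>0. \<forall>m\<in>W. C m = j}"

definition run_free :: "nat \<Rightarrow> nat \<Rightarrow> (nat \<Rightarrow> nat) set" where
  "run_free k n = {C. \<not> has_nonzero_run n k C}"

lemma cylinder_constant_nonzero_on: "cylinder_over W (constant_nonzero_on W)"
proof -
  have "f \<in> constant_nonzero_on W \<longleftrightarrow> g \<in> constant_nonzero_on W" if "\<forall>i\<in>W. f i = g i" for f g
    using that by (simp add: constant_nonzero_on_def cong: ball_cong)
  then show ?thesis unfolding cylinder_over_def by blast
qed

lemma cylinder_run_free: "cylinder_over {1..n} (run_free k n)"
proof -
  have "has_nonzero_run n k f \<longleftrightarrow> has_nonzero_run n k g" if eq: "\<forall>i\<in>{1..n}. f i = g i" for f g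
  proof -
    have "({i..<i + k} \<subseteq> {1..n} \<and> j > 0 \<and> (\<forall>m\<in>{i..<i + k}. f m = j)) \<longleftrightarrow>
          ({i..<i + k} \<subseteq> {1..n} \<and> j > 0 \<and> (\<forall>m\<in>{i..<i + k}. g m = j))" for i j
      using eq by (metis subsetD)
    then show ?thesis unfolding has_nonzero_run_def by simp
  qed
  then show ?thesis unfolding cylinder_over_def run_free_def by blast
qed

text \<open>The series over the common value sums to \<open>(q * p) ^ L / (1 - p ^ L)\<close> with \<open>q = 1 - p\<close>. A factor
  \<open>q\<close> is cancelled here, so that the formula stays continuous at \<open>p = 1\<close>.\<close>

definition window_prob :: "nat \<Rightarrow> real \<Rightarrow> real" where
  "window_prob L p = (1 - p) ^ (L - 1) * p ^ L / (\<Sum>i<L. p ^ i)"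

lemma sum_powers_ge_one:
  assumes "0 \<le> p" "L > 0" shows "(\<Sum>i<L. p ^ i) \<ge> (1::real)"
proof -
  have "p ^ 0 \<le> (\<Sum>i<L. p ^ i)"
    using assms by (intro member_le_sum) auto
  then show ?thesis by simp
qed

lemma prob_constant_nonzero:
  assumes W: "W \<subseteq> {1..n}" "W \<noteq> {}" and p: "0 \<le> p" "p < 1"
  shows "measure_pmf.prob (geometric_composition n p) (constant_nonzero_on W) = window_prob (card W) p"
proof -
  let ?L = "card W" and ?M = "geometric_composition n p"
  have fin: "finite W" using W finite_subset by blast
  then have L: "?L > 0" using W by (simp add: card_gt_0_iff)
  define B :: "nat \<Rightarrow> (nat \<Rightarrow> nat) set" where "B j = Pi W (\<lambda>_. {Suc j})" for j
  have prob_B: "measure_pmf.prob ?M (B j) = ((1 - p) * p) ^ ?L * (p ^ ?L) ^ j" for j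
  proof -
    have "cylinder_over W (B j)"
      unfolding cylinder_over_def B_def by (auto simp: Pi_iff)
    then have "measure_pmf.prob ?M (B j) = (\<Prod>x\<in>W. measure_pmf.prob (geometric_pmf (1 - p)) {Suc j})"
      unfolding geometric_composition_def using W fin
      by (subst prob_Pi_pmf_cylinder[of _ W]) (auto simp: B_def measure_Pi_pmf_Pi)
    then show ?thesis
      using p by (simp add: measure_pmf_single power_mult_distrib mult.commute flip: power_mult)
  qed
  have "p ^ ?L < 1" using p L by (simp add: power_less_one_iff)
  then have "(\<lambda>j. ((1 - p) * p) ^ ?L * (p ^ ?L) ^ j) sums (((1 - p) * p) ^ ?L * (1 / (1 - p ^ ?L)))"
    using p by (intro sums_mult geometric_sums) auto
  moreover have "(\<lambda>j. measure_pmf.prob ?M (B j)) sums measure_pmf.prob ?M (\<Union>j. B j)"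
  proof (rule measure_pmf.finite_measure_UNION)
    show "disjoint_family B"
      using W(2) unfolding disjoint_family_on_def B_def by (auto simp: Pi_iff ex_in_conv[symmetric])
  qed auto
  moreover have "(\<Union>j. B j) = constant_nonzero_on W"
    unfolding B_def constant_nonzero_on_def by (auto simp: Pi_iff gr0_conv_Suc)
  ultimately have "measure_pmf.prob ?M (constant_nonzero_on W) = ((1 - p) * p) ^ ?L / (1 - p ^ ?L)"
    unfolding prob_B by (simp add: sums_iff)
  also have "1 - p ^ ?L = (1 - p) * (\<Sum>i<?L. p ^ i)"
    by (rule one_diff_power_eq)
  also have "((1 - p) * p) ^ ?L / \<dots> = window_prob ?L p"
  proof -
    have "(1 - p) ^ ?L = (1 - p) * (1 - p) ^ (?L - 1)"
      using L by (simp add: power_eq_if)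
    then show ?thesis using p by (simp add: window_prob_def power_mult_distrib)
  qed
  finally show ?thesis .
qed

section \<open>The first position that completes a run\<close>

lemma has_nonzero_run_mono:
  "has_nonzero_run m k C \<Longrightarrow> m \<le> n \<Longrightarrow> has_nonzero_run n k C"
  unfolding has_nonzero_run_def
  by (meson atLeastatMost_subset_iff order_refl subset_trans)

lemma run_free_antimono: "m \<le> n \<Longrightarrow> run_free k n \<subseteq> run_free k m"
  unfolding run_free_def using has_nonzero_run_mono by blast

text \<open>Writing windows as \<open>{i + 1..i + k}\<close> turns the containment in \<open>{1..n}\<close> into a single inequality.\<close>

lemma has_nonzero_run_iff:
  assumes "k > 0"
  shows "has_nonzero_run n k C \<longleftrightarrow> 
    (\<exists>i. i + k \<le> n \<and> C \<in> constant_nonzero_on {i + 1..i + k})"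
proof
  assume "has_nonzero_run n k C"
  then obtain i j where i: "{i..<i + k} \<subseteq> {1..n}" "j > 0" "\<forall>m\<in>{i..<i + k}. C m = j"
    unfolding has_nonzero_run_def by blast
  have "i \<in> {i..<i + k}" "i + k - 1 \<in> {i..<i + k}" using assms by auto
  then have "i \<in> {1..n}" "i + k - 1 \<in> {1..n}" using i(1) by blast+
  then show "\<exists>i. i + k \<le> n \<and> C \<in> constant_nonzero_on {i + 1..i + k}"
    using i assms by (intro exI[of _ "i - 1"]) (auto simp: constant_nonzero_on_def intro!: exI[of _ j])
next
  assume "\<exists>i. i + k \<le> n \<and> C \<in> constant_nonzero_on {i + 1..i + k}"
  then obtain i j where "i + k \<le> n" "j > 0" "\<forall>m\<in>{i+1..i + k}. C m = j"
    unfolding constant_nonzero_on_def by blast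
  then show "has_nonzero_run n k C"
    unfolding has_nonzero_run_def by (intro exI[of _ "i + 1"] exI[of _ j]) auto
qed

lemma first_run_subset:
  assumes "k > 0"
  shows "run_free k (m + k - 1) - run_free k (m + k)
    \<subseteq> run_free k m \<inter> constant_nonzero_on {m + 1..m + k}"
proof
  fix C assume C: "C \<in> run_free k (m + k - 1) - run_free k (m + k)"
  then obtain i where i: "i + k \<le> m + k" "C \<in> constant_nonzero_on {i + 1..i + k}"
    unfolding run_free_def has_nonzero_run_iff[OF assms] by auto
  have "\<not> i + k \<le> m + k - 1"
    using C i(2) unfolding run_free_def has_nonzero_run_iff[OF assms] by auto
  then have "i = m" using i(1) by auto
  moreover have "C \<in> run_free k m"
    using C run_free_antimono[of m "m + k - 1" k] assms by fastforce
  ultimately show "C \<in> run_free k m \<inter> constant_nonzero_on {m + 1..m + k}"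
    using i by auto
qed

text \<open>Suppose that the window \<open>{m + 1..m + k}\<close> is a run and that an earlier run is not contained in the
  first \<open>m\<close> terms. Then the earlier run covers both \<open>m\<close> and \<open>m + 1\<close>. Its value is therefore that
  of the window, which extends the window to \<open>k + 1\<close> equal terms starting at \<open>m\<close>.\<close>

lemma first_run_supset:
  assumes "k > 0"
  shows "run_free k m \<inter> constant_nonzero_on {m + 1..m + k}
    \<subseteq> (run_free k (m + k - 1) - run_free k (m + k)) \<union> constant_nonzero_on {m..m + k}"
proof
  fix C assume C: "C \<in> run_free k m \<inter> constant_nonzero_on {m + 1..m + k}"
  have last: "C \<notin> run_free k (m + k)"
    using C unfolding run_free_def has_nonzero_run_iff[OF assms] by auto
  obtain j where j: "j > 0" "\<forall>x\<in>{m + 1..m + k}. C x = j"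
    using C unfolding constant_nonzero_on_def by auto
  show "C \<in> (run_free k (m + k - 1) - run_free k (m + k)) \<union> constant_nonzero_on {m..m + k}"
  proof (cases "C \<in> run_free k (m + k - 1)")
    case False
    then obtain i j' where i: "i + k \<le> m + k - 1" "j' > 0" "\<forall>x\<in>{i + 1..i + k}. C x = j'"
      unfolding run_free_def has_nonzero_run_iff[OF assms] constant_nonzero_on_def by auto
    have "i + k > m"
    proof (rule ccontr)
      assume "\<not> i + k > m"
      then have "has_nonzero_run m k C"
        unfolding has_nonzero_run_iff[OF assms] constant_nonzero_on_def using i
        by (intro exI[of _ i]) auto
      then show False using C unfolding run_free_def by auto
    qed
    then have "C (m + 1) = j'" "C m = j'" using i assms by auto
    moreover have "C (m + 1) = j" using j assms by auto
    ultimately have "C x = j" if "x \<in> {m..m + k}" for x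
      using j that by (cases "x = m") auto
    then show ?thesis using j(1) unfolding constant_nonzero_on_def by auto
  qed (use last in auto)
qed

definition run_free_prob :: "nat \<Rightarrow> real \<Rightarrow> nat \<Rightarrow> real" where
  "run_free_prob k p n = measure_pmf.prob (geometric_composition n p) (run_free k n)"

lemma run_prob_eq: "run_prob k n p = 1 - run_free_prob k p n"
proof -
  have "run_free k n = UNIV - {C. has_nonzero_run n k C}"
    unfolding run_free_def by auto
  then show ?thesis unfolding run_free_prob_def run_prob_def
    using measure_pmf.prob_compl[of "{C. has_nonzero_run n k C}" "geometric_composition n p"] by simp
qed

lemma prob_run_free:
  assumes "m \<le> n"
  shows "measure_pmf.prob (geometric_composition n p) (run_free k m) = run_free_prob k p m"
  unfolding run_free_prob_def geometric_composition_def using assms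
  by (intro prob_Pi_pmf_cylinder cylinder_run_free) auto

lemma run_free_prob_bounds: "0 \<le> run_free_prob k p n" "run_free_prob k p n \<le> 1"
  unfolding run_free_prob_def by auto

lemma run_free_prob_antimono: "m \<le> n \<Longrightarrow> run_free_prob k p n \<le> run_free_prob k p m"
  unfolding run_free_prob_def[of k p n] prob_run_free[of m n p k, symmetric]
  by (intro measure_pmf.finite_measure_mono run_free_antimono) auto

lemma run_free_prob_short: "n < k \<Longrightarrow> run_free_prob k p n = 1"
  unfolding run_free_prob_def run_free_def by (subst has_nonzero_run_iff) auto

context
  fixes k :: nat and p :: real
  assumes k: "k > 0" and p: "0 \<le> p" "p < 1"
begin

lemma prob_run_free_Int_window:
  "measure_pmf.prob (geometric_composition (m + k) p) (run_free k m \<inter> constant_nonzero_on {m + 1..m + k})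
   = run_free_prob k p m * window_prob k p"
proof -
  have "measure_pmf.prob (geometric_composition (m + k) p) (run_free k m \<inter> constant_nonzero_on {m + 1..m + k})
    = measure_pmf.prob (geometric_composition (m + k) p) (run_free k m) *
      measure_pmf.prob (geometric_composition (m + k) p) (constant_nonzero_on {m + 1..m + k})"
    unfolding geometric_composition_def
    by (rule prob_Pi_pmf_indep[of _ "{1..m}" "{m + 1..m + k}"])
       (auto intro: cylinder_run_free[simplified] cylinder_constant_nonzero_on)
  also have "measure_pmf.prob (geometric_composition (m + k) p) (constant_nonzero_on {m + 1..m + k}) = window_prob k p"
    using k p by (subst prob_constant_nonzero) auto
  finally show ?thesis by (simp add: prob_run_free)
qed

lemma run_free_prob_diff:
  "run_free_prob k p (m + k - 1) - run_free_prob k p (m + k) =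
     measure_pmf.prob (geometric_composition (m + k) p) (run_free k (m + k - 1) - run_free k (m + k))"
  by (subst measure_pmf.finite_measure_Diff)
     (auto simp: prob_run_free intro: subsetD[OF run_free_antimono, rotated])

lemma run_free_prob_decrement_le:
  "run_free_prob k p (m + k - 1) - run_free_prob k p (m + k) \<le> run_free_prob k p m * window_prob k p"
  unfolding run_free_prob_diff prob_run_free_Int_window[symmetric]
  by (intro measure_pmf.finite_measure_mono first_run_subset k) auto

lemma run_free_prob_decrement_ge:
  assumes "m > 0"
  shows "run_free_prob k p m * window_prob k p \<le>
     run_free_prob k p (m + k - 1) - run_free_prob k p (m + k) + window_prob (Suc k) p"
proof -
  let ?M = "geometric_composition (m + k) p"
  have "run_free_prob k p m * window_prob k p \<le> measure_pmf.prob ?M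
      ((run_free k (m + k - 1) - run_free k (m + k)) \<union> constant_nonzero_on {m..m + k})"
    unfolding prob_run_free_Int_window[symmetric]
    by (intro measure_pmf.finite_measure_mono first_run_supset k) auto
  also have "\<dots> \<le> measure_pmf.prob ?M (run_free k (m + k - 1) - run_free k (m + k)) +
      measure_pmf.prob ?M (constant_nonzero_on {m..m + k})"
    by (intro measure_subadditive) auto
  also have "measure_pmf.prob ?M (constant_nonzero_on {m..m + k}) = window_prob (Suc k) p"
    using assms p by (subst prob_constant_nonzero) (auto simp: Suc_diff_le)
  finally show ?thesis unfolding run_free_prob_diff .
qed

lemma run_free_prob_block: "run_free_prob k p (m + k) \<le> run_free_prob k p m * (1 - window_prob k p)"
proof -
  let ?M = "geometric_composition (m + k) p"
  let ?W = "constant_nonzero_on {m + 1..m + k}"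
  have "run_free k (m + k) \<inter> ?W = {}"
    unfolding run_free_def has_nonzero_run_iff[OF k] by auto
  then have "run_free k (m + k) \<subseteq> run_free k m - run_free k m \<inter> ?W"
    using run_free_antimono[of m "m + k" k] by auto
  then have "run_free_prob k p (m + k) \<le> measure_pmf.prob ?M (run_free k m - run_free k m \<inter> ?W)"
    unfolding run_free_prob_def by (intro measure_pmf.finite_measure_mono) auto
  also have "\<dots> = measure_pmf.prob ?M (run_free k m) - measure_pmf.prob ?M (run_free k m \<inter> ?W)"
    by (subst measure_pmf.finite_measure_Diff) auto
  also have "\<dots> = run_free_prob k p m * (1 - window_prob k p)"
    unfolding prob_run_free_Int_window by (simp add: prob_run_free algebra_simps)
  finally show ?thesis .
qed

lemma window_prob_bounds: "0 \<le> window_prob k p" "window_prob k p \<le> 1"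
proof -
  have "measure_pmf.prob (geometric_composition k p) (constant_nonzero_on {1..k}) = window_prob k p"
    using k p by (subst prob_constant_nonzero) auto
  then show "0 \<le> window_prob k p" "window_prob k p \<le> 1"
    by (metis measure_nonneg, metis measure_pmf.prob_le_1)
qed

end


section \<open>Sequences decaying with a bounded delay\<close>

lemma exp_le_one_minus_power:
  fixes s :: real
  assumes "0 \<le> s" "s < 1"
  shows "exp (- (real n * s / (1 - s))) \<le> (1 - s) ^ n"
proof -
  have "1 / (1 - s) = 1 + s / (1 - s)"
    using assms by (simp add: field_simps)
  also have "\<dots> \<le> exp (s / (1 - s))"
    by (rule exp_ge_add_one_self)
  finally have "exp (- (s / (1 - s))) \<le> 1 - s"
    using assms by (simp add: exp_minus field_simps)
  then have "exp (- (s / (1 - s))) ^ n \<le> (1 - s) ^ n"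
    by (intro power_mono) auto
  then show ?thesis
    by (simp flip: exp_of_nat_mult)
qed

lemma one_minus_power_le_exp:
  fixes s :: real
  assumes "s \<le> 1"
  shows "(1 - s) ^ n \<le> exp (- (real n * s))"
proof -
  have "(1 - s) ^ n \<le> exp (- s) ^ n"
    using assms exp_ge_add_one_self[of "- s"] by (intro power_mono) auto
  then show ?thesis by (simp flip: exp_of_nat_mult)
qed

text \<open>The properties of the probabilities \<open>u n\<close> of having no run among \<open>n\<close> terms that determine their
  limit: in each step \<open>u\<close> loses a proportion \<open>s\<close> of the value it had \<open>k - 1\<close> steps before, up to an error
  \<open>e\<close>, and over a full block of \<open>k\<close> steps it loses at least a proportion \<open>s\<close> with no error at all.\<close>

locale delayed_decay =
  fixes u :: "nat \<Rightarrow> real" and s e :: real and k :: nat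
  assumes k_pos: "k > 0" and s_bounds: "0 \<le> s" "s \<le> 1" and e_nonneg: "0 \<le> e"
    and u_bounds: "\<And>n. 0 \<le> u n" "\<And>n. u n \<le> 1"
    and u_short: "\<And>n. n < k \<Longrightarrow> u n = 1"
    and u_antimono: "\<And>m n. m \<le> n \<Longrightarrow> u n \<le> u m"
    and decrement_le: "\<And>m. u (m + k - 1) - u (m + k) \<le> s * u m"
    and decrement_ge: "\<And>m. m > 0 \<Longrightarrow> s * u m \<le> u (m + k - 1) - u (m + k) + e"
    and block: "\<And>m. u (m + k) \<le> (1 - s) * u m"
begin

lemma decrement_le_s: "u n - u (Suc n) \<le> s"
proof (cases "Suc n < k")
  case True
  then show ?thesis using u_short[of n] u_short[of "Suc n"] s_bounds by simp
next
  case False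
  then obtain m where m: "Suc n = m + k" by (metis add.commute le_Suc_ex not_less)
  then have "n = m + k - 1" using k_pos by simp
  moreover have "s * u m \<le> s" using s_bounds u_bounds[of m] by (simp add: mult_left_le)
  ultimately show ?thesis using decrement_le[of m] m by simp
qed

lemma decrease_le: "u m - u (m + j) \<le> real j * s"
proof (induction j)
  case (Suc j)
  then show ?case using decrement_le_s[of "m + j"] by (simp add: algebra_simps)
qed simp

text \<open>The delay is removed at second-order cost: \<open>u\<close> decreases by at most \<open>k s\<close> over the delay, which
  the factor \<open>s\<close> turns into \<open>k s\<^sup>2\<close>. In the opposite direction, monotonicity alone suffices.\<close>

lemma recursion_ge: "u (Suc n) \<ge> (1 - s) * u n - real k * s ^ 2"
proof (cases "Suc n < k")
  case True
  have "0 \<le> real k * s ^ 2" by simp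
  then have "(1 - s) - real k * s ^ 2 \<le> 1" using s_bounds(1) by linarith
  then show ?thesis using True by (simp add: u_short)
next
  case False
  then obtain m where m: "Suc n = m + k" by (metis add.commute le_Suc_ex not_less)
  then have n: "n = m + (k - 1)" using k_pos by simp
  have "u m \<le> u n + real (k - 1) * s"
    using decrease_le[of m "k - 1"] n by simp
  also have "\<dots> \<le> u n + real k * s"
    using s_bounds by (intro add_left_mono mult_right_mono) auto
  finally have "s * u m \<le> s * (u n + real k * s)"
    using s_bounds by (intro mult_left_mono)
  moreover have "u n - u (Suc n) \<le> s * u m"
    using decrement_le[of m] n m k_pos by simp
  ultimately show ?thesis by (simp add: algebra_simps power2_eq_square)
qed

lemma recursion_le: "n \<ge> k \<Longrightarrow> u (Suc n) \<le> (1 - s) * u n + e"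
proof -
  assume "n \<ge> k"
  define m where "m = Suc n - k"
  have m: "m > 0" "Suc n = m + k" "n = m + k - 1" "m \<le> n"
    using \<open>n \<ge> k\<close> k_pos by (auto simp: m_def)
  have "s * u n \<le> s * u m" using u_antimono[OF m(4)] s_bounds by (intro mult_left_mono)
  also have "\<dots> \<le> u n - u (Suc n) + e" using decrement_ge[OF m(1)] unfolding m(2) m(3)[symmetric] .
  finally show ?thesis by (simp add: algebra_simps)
qed

lemma power_lower_bound: "u n \<ge> (1 - s) ^ n - real n * real k * s ^ 2"
proof (induction n)
  case 0
  then show ?case using u_short k_pos by simp
next
  case (Suc n)
  let ?d = "real k * s ^ 2"
  have "(1 - s) ^ Suc n - real n * ?d \<le> (1 - s) ^ Suc n - (1 - s) * (real n * ?d)"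
    using s_bounds by (intro diff_left_mono mult_left_le_one_le) auto
  also have "\<dots> = (1 - s) * ((1 - s) ^ n - real n * ?d)"
    by (simp add: algebra_simps)
  also have "\<dots> \<le> (1 - s) * u n"
    using Suc s_bounds by (intro mult_left_mono) (auto simp: mult.assoc)
  also have "\<dots> \<le> u (Suc n) + ?d"
    using recursion_ge[of n] by simp
  finally show ?case by (simp add: algebra_simps)
qed

lemma power_upper_bound: "u (k + j) \<le> (1 - s) ^ j + real j * e"
proof (induction j)
  case 0
  then show ?case using u_bounds by simp
next
  case (Suc j)
  have "u (k + Suc j) \<le> (1 - s) * u (k + j) + e"
    using recursion_le[of "k + j"] by simp
  also have "(1 - s) * u (k + j) \<le> (1 - s) * ((1 - s) ^ j + real j * e)"
    using Suc s_bounds by (intro mult_left_mono) auto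
  also have "\<dots> = (1 - s) ^ Suc j + (1 - s) * (real j * e)"
    by (simp add: algebra_simps)
  also have "(1 - s) * (real j * e) \<le> real j * e"
    using s_bounds e_nonneg by (intro mult_left_le_one_le) auto
  finally show ?case by (simp add: algebra_simps)
qed

lemma block_bound: "u (j * k) \<le> (1 - s) ^ j"
proof (induction j)
  case (Suc j)
  have "u (Suc j * k) \<le> (1 - s) * u (j * k)"
    using block[of "j * k"] by (simp add: add.commute)
  also have "\<dots> \<le> (1 - s) * (1 - s) ^ j"
    using Suc s_bounds by (intro mult_left_mono) auto
  finally show ?case by simp
qed (use u_bounds in simp)

lemma exp_lower_bound:
  assumes "s < 1"
  shows "exp (- (real n * s / (1 - s))) - real k * s * (real n * s) \<le> u n"
  using exp_le_one_minus_power[OF s_bounds(1) assms, of n] power_lower_bound[of n]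
  by (simp add: power2_eq_square algebra_simps)

lemma exp_upper_bound:
  assumes "n \<ge> k"
  shows "u n \<le> exp (real k * s - real n * s) + real n * e"
proof -
  have "u n \<le> (1 - s) ^ (n - k) + real (n - k) * e"
    using power_upper_bound[of "n - k"] assms by simp
  also have "\<dots> \<le> exp (- (real (n - k) * s)) + real n * e"
    using one_minus_power_le_exp[OF s_bounds(2)] e_nonneg
    by (intro add_mono mult_right_mono) auto
  also have "- (real (n - k) * s) = real k * s - real n * s"
    using assms by (simp add: of_nat_diff algebra_simps)
  finally show ?thesis .
qed

lemma exp_block_bound: "u n \<le> exp (1 - real n * s / real k)"
proof -
  have "real n = real (n div k) * real k + real (n mod k)"
    by (metis div_mult_mod_eq of_nat_add of_nat_mult)
  also have "\<dots> \<le> (real (n div k) + 1) * real k"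
    using k_pos mod_less_divisor[of k n] by (simp add: algebra_simps)
  finally have "real n / real k \<le> real (n div k) + 1"
    using k_pos by (simp add: divide_le_eq)
  then have "real n / real k * s \<le> (real (n div k) + 1) * s"
    using s_bounds by (intro mult_right_mono) auto
  then have "- (real (n div k) * s) \<le> 1 - real n * s / real k"
    using s_bounds by (simp add: algebra_simps)
  moreover have "u n \<le> u (n div k * k)" by (intro u_antimono) simp
  moreover have "u (n div k * k) \<le> exp (- (real (n div k) * s))"
    using block_bound[of "n div k"] one_minus_power_le_exp[OF s_bounds(2), of "n div k"] by simp
  ultimately show ?thesis
    by (meson exp_le_cancel_iff order_trans)
qed

end

text \<open>Since \<open>n s\<close> converges, \<open>s\<close> tends to 0; so the error \<open>n k s\<^sup>2 = k s (n s)\<close>, the correction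
  \<open>k s\<close> for the initial segment and the denominator \<open>1 - s\<close> have no influence on the limit.\<close>

lemma delayed_decay_tendsto_exp:
  fixes u :: "nat \<Rightarrow> nat \<Rightarrow> real" and s e :: "nat \<Rightarrow> real"
  assumes decay: "\<And>n. delayed_decay (u n) (s n) (e n) k"
    and s: "(\<lambda>n. real n * s n) \<longlonglongrightarrow> l"
    and e: "(\<lambda>n. real n * e n) \<longlonglongrightarrow> 0"
  shows "(\<lambda>n. u n n) \<longlonglongrightarrow> exp (- l)"
proof -
  have s0: "s \<longlonglongrightarrow> 0"
  proof -
    have "(\<lambda>n. real n * s n * inverse (real n)) \<longlonglongrightarrow> l * 0"
      by (intro tendsto_mult s lim_inverse_n)
    moreover have "\<forall>\<^sub>F n in sequentially. real n * s n * inverse (real n) = s n"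
      using eventually_gt_at_top[of 0] by eventually_elim simp
    ultimately show ?thesis
      using Lim_transform_eventually by fastforce
  qed
  then have s_lt: "eventually (\<lambda>n. s n < 1) sequentially"
    by (rule order_tendstoD) simp
  show ?thesis
  proof (rule tendsto_sandwich)
    show "\<forall>\<^sub>F n in sequentially. exp (- (real n * s n / (1 - s n))) - real k * s n * (real n * s n) \<le> u n n"
      using s_lt by eventually_elim (rule delayed_decay.exp_lower_bound[OF decay])
    show "\<forall>\<^sub>F n in sequentially. u n n \<le> exp (real k * s n - real n * s n) + real n * e n"
      using eventually_ge_at_top[of k] by eventually_elim (rule delayed_decay.exp_upper_bound[OF decay])
    have "(\<lambda>n. exp (- (real n * s n / (1 - s n))) - real k * s n * (real n * s n)) \<longlonglongrightarrow>
        exp (- (l / (1 - 0))) - real k * 0 * l"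
      by (intro tendsto_intros s s0) simp
    then show "(\<lambda>n. exp (- (real n * s n / (1 - s n))) - real k * s n * (real n * s n)) \<longlonglongrightarrow> exp (- l)"
      by simp
    have "(\<lambda>n. exp (real k * s n - real n * s n) + real n * e n) \<longlonglongrightarrow> exp (real k * 0 - l) + 0"
      by (intro tendsto_intros s s0 e)
    then show "(\<lambda>n. exp (real k * s n - real n * s n) + real n * e n) \<longlonglongrightarrow> exp (- l)"
      by simp
  qed
qed

text \<open>Here \<open>n e\<close> may diverge together with \<open>n s\<close>: in the intermediate range \<open>p\<close> can stay away from both 0
  and 1. Independent blocks give a bound that is free of \<open>e\<close>.\<close>

lemma delayed_decay_tendsto_0:
  fixes u :: "nat \<Rightarrow> nat \<Rightarrow> real" and s e :: "nat \<Rightarrow> real"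
  assumes decay: "\<And>n. delayed_decay (u n) (s n) (e n) k"
    and s: "filterlim (\<lambda>n. real n * s n) at_top sequentially"
  shows "(\<lambda>n. u n n) \<longlonglongrightarrow> 0"
proof (rule tendsto_sandwich[of "\<lambda>_. 0"])
  have "k > 0" by (rule delayed_decay.k_pos[OF decay[of 0]])
  then have "filterlim (\<lambda>n. - 1 + 1 / real k * (real n * s n)) at_top sequentially"
    by (intro filterlim_tendsto_add_at_top[OF tendsto_const]
          filterlim_tendsto_pos_mult_at_top[OF tendsto_const] s) simp
  then have "filterlim (\<lambda>n. 1 - real n * s n / real k) at_bot sequentially"
    by (subst filterlim_uminus_at_bot) simp
  then show "(\<lambda>n. exp (1 - real n * s n / real k)) \<longlonglongrightarrow> 0"
    by (rule filterlim_compose[OF exp_at_bot])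
  show "\<forall>\<^sub>F n in sequentially. u n n \<le> exp (1 - real n * s n / real k)"
    by (intro always_eventually allI delayed_decay.exp_block_bound[OF decay])
qed (auto intro!: always_eventually delayed_decay.u_bounds[OF decay])

section \<open>Scales of the form \<open>n powr (- 1 / m)\<close>\<close>

lemma power_root_scale:
  assumes "m > 0" "n > 0"
  shows "(real n powr (- 1 / real m)) ^ m = 1 / real n"
proof -
  have "(real n powr (- 1 / real m)) ^ m = (real n powr (- 1 / real m)) powr real m"
    using assms by (simp add: powr_realpow)
  also have "\<dots> = real n powr - 1"
    using assms by (simp add: powr_powr)
  finally show ?thesis by (simp add: powr_minus_divide)
qed

lemma scaled_power_tendsto:
  fixes f :: "nat \<Rightarrow> real"
  assumes m: "m > 0" and f: "(\<lambda>n. f n / real n powr (- 1 / real m)) \<longlonglongrightarrow> c"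
  shows "(\<lambda>n. real n * f n ^ m) \<longlonglongrightarrow> c ^ m"
proof (rule Lim_transform_eventually)
  show "(\<lambda>n. (f n / real n powr (- 1 / real m)) ^ m) \<longlonglongrightarrow> c ^ m"
    by (intro tendsto_power f)
  show "\<forall>\<^sub>F n in sequentially. (f n / real n powr (- 1 / real m)) ^ m = real n * f n ^ m"
    using eventually_gt_at_top[of 0]
  proof eventually_elim
    case (elim n)
    have "(f n / real n powr (- 1 / real m)) ^ m = f n ^ m / (1 / real n)"
      using power_root_scale[OF m elim] by (simp add: power_divide)
    then show ?case by simp
  qed
qed

lemma scaled_power_at_top:
  fixes f :: "nat \<Rightarrow> real"
  assumes m: "m > 0" and nonneg: "\<And>n. 0 \<le> f n"
    and f: "(\<lambda>n. real n powr (- 1 / real m)) \<in> o(f)"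
  shows "filterlim (\<lambda>n. real n * f n ^ m) at_top sequentially"
  unfolding filterlim_at_top_gt[of _ _ 1]
proof (intro allI impI)
  fix Z :: real assume Z: "Z > 1"
  have "\<forall>\<^sub>F n in sequentially. norm (real n powr (- 1 / real m)) \<le> 1 / Z * norm (f n)"
    using Z by (intro landau_o.smallD[OF f]) auto
  then show "\<forall>\<^sub>F n in sequentially. Z \<le> real n * f n ^ m"
    using eventually_gt_at_top[of 0]
  proof eventually_elim
    case (elim n)
    have "Z * real n powr (- 1 / real m) \<le> f n"
      using elim(1) Z nonneg[of n] by (simp add: field_simps)
    then have "(Z * real n powr (- 1 / real m)) ^ m \<le> f n ^ m"
      using Z by (intro power_mono) auto
    then have "Z ^ m / real n \<le> f n ^ m"
      using power_root_scale[OF m elim(2)] by (simp add: power_mult_distrib)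
    then have "Z ^ m \<le> real n * f n ^ m"
      using elim(2) by (simp add: field_simps)
    moreover have "Z ^ 1 \<le> Z ^ m" using Z m by (intro power_increasing) auto
    ultimately show ?case by simp
  qed
qed

lemma root_scale_tendsto_0:
  assumes "m > 0"
  shows "(\<lambda>n. real n powr (- 1 / real m)) \<longlonglongrightarrow> 0"
  using assms by (intro tendsto_neg_powr filterlim_real_sequentially) auto

lemma ratio_tendsto_imp_tendsto_0:
  fixes f :: "nat \<Rightarrow> real"
  assumes m: "m > 0" and f: "(\<lambda>n. f n / real n powr (- 1 / real m)) \<longlonglongrightarrow> c"
  shows "f \<longlonglongrightarrow> 0"
proof (rule Lim_transform_eventually)
  show "(\<lambda>n. f n / real n powr (- 1 / real m) * real n powr (- 1 / real m)) \<longlonglongrightarrow> 0"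
    using tendsto_mult[OF f root_scale_tendsto_0[OF m]] by simp
  show "\<forall>\<^sub>F n in sequentially. f n / real n powr (- 1 / real m) * real n powr (- 1 / real m) = f n"
    using eventually_gt_at_top[of 0] by eventually_elim simp
qed

lemma asymp_equiv_imp_ratio:
  assumes "f \<sim>[sequentially] (\<lambda>n. \<alpha> * real n powr a)" "\<alpha> \<noteq> 0"
  shows "(\<lambda>n. f n / real n powr a) \<longlonglongrightarrow> \<alpha>"
proof (rule Lim_transform_eventually)
  have "(\<lambda>n. f n / (\<alpha> * real n powr a)) \<longlonglongrightarrow> 1"
    using assms(1)
  proof (rule asymp_equivD_strong)
    show "\<forall>\<^sub>F n in sequentially. f n \<noteq> 0 \<or> \<alpha> * real n powr a \<noteq> 0"
      using eventually_gt_at_top[of 0] by eventually_elim (use assms(2) in simp)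
  qed
  then show "(\<lambda>n. \<alpha> * (f n / (\<alpha> * real n powr a))) \<longlonglongrightarrow> \<alpha>"
    using tendsto_mult[OF tendsto_const[of \<alpha>]] by fastforce
qed (use assms(2) in auto)

section \<open>Limits of the run probability\<close>

lemma run_free_prob_decay:
  assumes "k > 0" "0 \<le> p" "p < 1"
  shows "delayed_decay (run_free_prob k p) (window_prob k p) (window_prob (Suc k) p) k"
proof
  show "run_free_prob k p (m + k) \<le> (1 - window_prob k p) * run_free_prob k p m" for m
    using run_free_prob_block[OF assms, of m] by (simp add: mult.commute)
  show "run_free_prob k p (m + k - 1) - run_free_prob k p (m + k) \<le> window_prob k p * run_free_prob k p m" for m
    using run_free_prob_decrement_le[OF assms, of m] by (simp add: mult.commute)
  show "window_prob k p * run_free_prob k p m \<le>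
      run_free_prob k p (m + k - 1) - run_free_prob k p (m + k) + window_prob (Suc k) p" if "m > 0" for m
    using run_free_prob_decrement_ge[OF assms that] by (simp add: mult.commute)
qed (use assms window_prob_bounds[of k p] window_prob_bounds[of "Suc k" p] in
     \<open>auto simp: run_free_prob_bounds run_free_prob_antimono run_free_prob_short\<close>)

text \<open>Given a constant window of \<open>k\<close> terms, extending it by one more term multiplies the probability by at
  most \<open>max\<^sub>j q p\<^sup>j = q p\<close> over the positive values \<open>j\<close>. So clumping is negligible as soon as \<open>q p\<close>
  tends to 0.\<close>

lemma window_prob_Suc_le:
  assumes "k > 0" "0 \<le> p" "p < 1"
  shows "window_prob (Suc k) p \<le> window_prob k p * ((1 - p) * p)"
proof -
  have "window_prob (Suc k) p \<le> (1 - p) ^ k * p ^ Suc k / (\<Sum>i<k. p ^ i)"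
    unfolding window_prob_def using assms sum_powers_ge_one[of p k]
    by (auto intro!: divide_left_mono add_pos_nonneg mult_pos_pos)
  also have "(1 - p) ^ k = (1 - p) ^ (k - 1) * (1 - p)"
    using assms(1) by (simp add: power_eq_if)
  finally show ?thesis by (simp add: window_prob_def mult_ac)
qed

lemma run_prob_tendsto_poisson:
  assumes k: "k > 0" and p: "\<And>n. 0 \<le> p n" "\<And>n. p n < 1"
    and mean: "(\<lambda>n. real n * window_prob k (p n)) \<longlonglongrightarrow> l"
    and clump: "(\<lambda>n. (1 - p n) * p n) \<longlonglongrightarrow> 0"
  shows "(\<lambda>n. run_prob k n (p n)) \<longlonglongrightarrow> 1 - exp (- l)"
proof -
  have "(\<lambda>n. real n * window_prob (Suc k) (p n)) \<longlonglongrightarrow> 0"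
  proof (rule tendsto_sandwich[of "\<lambda>_. 0"])
    show "\<forall>\<^sub>F n in sequentially. real n * window_prob (Suc k) (p n) \<le>
        real n * window_prob k (p n) * ((1 - p n) * p n)"
      using window_prob_Suc_le[OF k p] by (auto simp: mult.assoc intro!: always_eventually mult_left_mono)
    show "(\<lambda>n. real n * window_prob k (p n) * ((1 - p n) * p n)) \<longlonglongrightarrow> 0"
      using tendsto_mult[OF mean clump] by simp
    show "\<forall>\<^sub>F n in sequentially. 0 \<le> real n * window_prob (Suc k) (p n)"
      using window_prob_bounds(1)[of "Suc k"] p by (auto intro!: always_eventually)
  qed simp
  then have "(\<lambda>n. run_free_prob k (p n) n) \<longlonglongrightarrow> exp (- l)"
    using delayed_decay_tendsto_exp[OF run_free_prob_decay[OF k p] mean] by simp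
  then show ?thesis unfolding run_prob_eq by (intro tendsto_intros)
qed

lemma run_prob_tendsto_1:
  assumes k: "k > 0" and p: "\<And>n. 0 \<le> p n" "\<And>n. p n < 1"
    and mean: "filterlim (\<lambda>n. real n * window_prob k (p n)) at_top sequentially"
  shows "(\<lambda>n. run_prob k n (p n)) \<longlonglongrightarrow> 1"
  unfolding run_prob_eq
  using tendsto_diff[OF tendsto_const delayed_decay_tendsto_0[OF run_free_prob_decay[OF k p] mean], of 1]
  by simp

text \<open>Allowing \<open>c = 0\<close> covers both the scale of the threshold and the range below it; likewise for the
  upper threshold.\<close>

lemma run_prob_tendsto_small_p:
  assumes k: "k > 0" and p: "\<And>n. 0 \<le> p n" "\<And>n. p n < 1"
    and ratio: "(\<lambda>n. p n / real n powr (- 1 / real k)) \<longlonglongrightarrow> c"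
  shows "(\<lambda>n. run_prob k n (p n)) \<longlonglongrightarrow> 1 - exp (- (c ^ k))"
proof (rule run_prob_tendsto_poisson[OF k p])
  have p0: "p \<longlonglongrightarrow> 0" by (rule ratio_tendsto_imp_tendsto_0[OF k ratio])
  have one: "(\<Sum>i<k. (0::real) ^ i) = 1"
    using k by (simp add: power_0_left sum.delta)
  have "(\<lambda>n. real n * p n ^ k * ((1 - p n) ^ (k - 1) / (\<Sum>i<k. p n ^ i))) \<longlonglongrightarrow>
      c ^ k * ((1 - 0) ^ (k - 1) / (\<Sum>i<k. 0 ^ i))"
    by (intro tendsto_mult scaled_power_tendsto[OF k ratio] tendsto_intros p0) (simp add: one)
  then show "(\<lambda>n. real n * window_prob k (p n)) \<longlonglongrightarrow> c ^ k"
    by (simp add: one window_prob_def mult_ac)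
  have "(\<lambda>n. (1 - p n) * p n) \<longlonglongrightarrow> (1 - 0) * 0"
    by (intro tendsto_intros p0)
  then show "(\<lambda>n. (1 - p n) * p n) \<longlonglongrightarrow> 0" by simp
qed

lemma run_prob_tendsto_small_q:
  assumes k: "k \<ge> 2" and p: "\<And>n. 0 \<le> p n" "\<And>n. p n < 1"
    and ratio: "(\<lambda>n. (1 - p n) / real n powr (- 1 / real (k - 1))) \<longlonglongrightarrow> c"
  shows "(\<lambda>n. run_prob k n (p n)) \<longlonglongrightarrow> 1 - exp (- (c ^ (k - 1) / real k))"
proof (rule run_prob_tendsto_poisson[OF _ p])
  have k1: "k - 1 > 0" using k by simp
  have q0: "(\<lambda>n. 1 - p n) \<longlonglongrightarrow> 0" by (rule ratio_tendsto_imp_tendsto_0[OF k1 ratio])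
  then have p1: "p \<longlonglongrightarrow> 1"
    using tendsto_diff[OF tendsto_const[of 1] q0] by simp
  have "(\<lambda>n. real n * (1 - p n) ^ (k - 1) * (p n ^ k / (\<Sum>i<k. p n ^ i))) \<longlonglongrightarrow>
      c ^ (k - 1) * (1 ^ k / (\<Sum>i<k. 1 ^ i))"
    by (intro tendsto_mult scaled_power_tendsto[OF k1 ratio] tendsto_intros p1) (use k in simp)
  then show "(\<lambda>n. real n * window_prob k (p n)) \<longlonglongrightarrow> c ^ (k - 1) / real k"
    by (simp add: window_prob_def mult_ac)
  show "(\<lambda>n. (1 - p n) * p n) \<longlonglongrightarrow> 0"
    using tendsto_mult[OF q0 p1] by simp
qed (use k in simp)

text \<open>The denominator \<open>\<Sum>i<k. p ^ i\<close> is at most \<open>k\<close>, and whichever of \<open>p\<close> and \<open>1 - p\<close> is at least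
  one half contributes a power that is at least \<open>1 / 2 ^ k\<close>.\<close>

lemma window_prob_ge_min:
  assumes k: "k > 0" and p: "0 \<le> p" "p < 1"
  shows "window_prob k p \<ge> min (p ^ k) ((1 - p) ^ (k - 1)) / (real k * 2 ^ k)"
proof -
  have "(\<Sum>i<k. p ^ i) \<le> real (card {..<k}) * 1"
    using p by (intro sum_bounded_above power_le_one) auto
  then have "(1 - p) ^ (k - 1) * p ^ k / real k \<le> window_prob k p"
    unfolding window_prob_def using p k sum_powers_ge_one[of p k]
    by (intro divide_left_mono) (auto intro!: mult_nonneg_nonneg mult_pos_pos)
  moreover have "min (p ^ k) ((1 - p) ^ (k - 1)) / 2 ^ k \<le> (1 - p) ^ (k - 1) * p ^ k"
  proof (cases "p \<le> 1 / 2")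
    case True
    have "(1 / 2) ^ k \<le> (1 / 2 :: real) ^ (k - 1)"
      by (intro power_decreasing) auto
    also have "\<dots> \<le> (1 - p) ^ (k - 1)"
      using True by (intro power_mono) auto
    finally have "p ^ k * (1 / 2) ^ k \<le> p ^ k * (1 - p) ^ (k - 1)"
      using p by (intro mult_left_mono) auto
    moreover have "min (p ^ k) ((1 - p) ^ (k - 1)) / 2 ^ k \<le> p ^ k / 2 ^ k"
      by (intro divide_right_mono) auto
    ultimately show ?thesis by (simp add: power_divide mult.commute)
  next
    case False
    have "(1 / 2) ^ k \<le> p ^ k"
      using False by (intro power_mono) auto
    then have "(1 - p) ^ (k - 1) * (1 / 2) ^ k \<le> (1 - p) ^ (k - 1) * p ^ k"
      using p by (intro mult_left_mono) auto
    moreover have "min (p ^ k) ((1 - p) ^ (k - 1)) / 2 ^ k \<le> (1 - p) ^ (k - 1) / 2 ^ k"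
      by (intro divide_right_mono) auto
    ultimately show ?thesis by (simp add: power_divide)
  qed
  then have "min (p ^ k) ((1 - p) ^ (k - 1)) / 2 ^ k / real k \<le> (1 - p) ^ (k - 1) * p ^ k / real k"
    by (intro divide_right_mono) auto
  ultimately show ?thesis by (simp add: mult.commute)
qed

lemma run_prob_tendsto_1_between:
  assumes k: "k \<ge> 2" and p: "\<And>n. 0 \<le> p n" "\<And>n. p n < 1"
    and p_large: "(\<lambda>n. real n powr (- 1 / real k)) \<in> o(p)"
    and q_large: "(\<lambda>n. real n powr (- 1 / real (k - 1))) \<in> o(\<lambda>n. 1 - p n)"
  shows "(\<lambda>n. run_prob k n (p n)) \<longlonglongrightarrow> 1"
proof (rule run_prob_tendsto_1[OF _ p])
  have k0: "k > 0" "k - 1 > 0" using k by auto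
  let ?c = "real k * 2 ^ k"
  have np: "filterlim (\<lambda>n. real n * p n ^ k) at_top sequentially"
    by (rule scaled_power_at_top[OF k0(1) p(1) p_large])
  have nq: "filterlim (\<lambda>n. real n * (1 - p n) ^ (k - 1)) at_top sequentially"
    by (rule scaled_power_at_top[OF k0(2) _ q_large]) (use p(2) less_imp_le in auto)
  show "filterlim (\<lambda>n. real n * window_prob k (p n)) at_top sequentially"
    unfolding filterlim_at_top
  proof
    fix Z :: real
    have "\<forall>\<^sub>F n in sequentially. Z * ?c \<le> real n * p n ^ k"
      using np by (simp add: filterlim_at_top)
    moreover have "\<forall>\<^sub>F n in sequentially. Z * ?c \<le> real n * (1 - p n) ^ (k - 1)"
      using nq by (simp add: filterlim_at_top)
    ultimately show "\<forall>\<^sub>F n in sequentially. Z \<le> real n * window_prob k (p n)"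
    proof eventually_elim
      case (elim n)
      then have "Z * ?c \<le> real n * min (p n ^ k) ((1 - p n) ^ (k - 1))"
        by (simp add: min_def)
      then have "Z \<le> real n * (min (p n ^ k) ((1 - p n) ^ (k - 1)) / ?c)"
        using k by (simp add: pos_le_divide_eq)
      also have "\<dots> \<le> real n * window_prob k (p n)"
        using window_prob_ge_min[OF k0(1) p] by (intro mult_left_mono) auto
      finally show ?case .
    qed
  qed
qed (use k in simp)

theorem proposition4p3:
  fixes p q :: "nat \<Rightarrow> real" and k :: nat and \<alpha> :: real
  assumes "\<And>n. 0 \<le> p n" and "\<And>n. p n < 1"
    and "\<And>n. q n = 1 - p n"
    and "k \<ge> 2" and "\<alpha> > 0"
  shows
    "(p \<in> o(\<lambda>n. real n powr (- 1 / real k)) \<longrightarrow>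
       (\<lambda>n. run_prob k n (p n)) \<longlonglongrightarrow> 0) \<and>
     (p \<sim>[sequentially] (\<lambda>n. \<alpha> * real n powr (- 1 / real k)) \<longrightarrow>
       (\<lambda>n. run_prob k n (p n)) \<longlonglongrightarrow> 1 - exp (- (\<alpha> ^ k))) \<and>
     ((\<lambda>n. real n powr (- 1 / real k)) \<in> o(p) \<and>
      (\<lambda>n. real n powr (- 1 / (real k - 1))) \<in> o(q) \<longrightarrow>
       (\<lambda>n. run_prob k n (p n)) \<longlonglongrightarrow> 1) \<and>
     (q \<sim>[sequentially] (\<lambda>n. \<alpha> * real n powr (- 1 / (real k - 1))) \<longrightarrow>
       (\<lambda>n. run_prob k n (p n)) \<longlonglongrightarrow> 1 - exp (- (\<alpha> ^ (k - 1) / real k))) \<and>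
     (q \<in> o(\<lambda>n. real n powr (- 1 / (real k - 1))) \<longrightarrow>
       (\<lambda>n. run_prob k n (p n)) \<longlonglongrightarrow> 0)"
proof -
  note p = assms(1,2)
  have q: "q = (\<lambda>n. 1 - p n)" using assms(3) by auto
  have k: "k > 0" "k - 1 > 0" "real k - 1 = real (k - 1)" using assms(4) by auto
  show ?thesis unfolding q k(3)
  proof (intro conjI impI)
    assume "p \<in> o(\<lambda>n. real n powr (- 1 / real k))"
    from run_prob_tendsto_small_p[OF k(1) p smalloD_tendsto[OF this]] k(1)
    show "(\<lambda>n. run_prob k n (p n)) \<longlonglongrightarrow> 0" by (simp add: power_0_left)
  next
    assume "p \<sim>[sequentially] (\<lambda>n. \<alpha> * real n powr (- 1 / real k))"
    then show "(\<lambda>n. run_prob k n (p n)) \<longlonglongrightarrow> 1 - exp (- (\<alpha> ^ k))"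
      using assms(5) by (intro run_prob_tendsto_small_p[OF k(1) p] asymp_equiv_imp_ratio) auto
  next
    assume "(\<lambda>n. real n powr (- 1 / real k)) \<in> o(p) \<and>
      (\<lambda>n. real n powr (- 1 / real (k - 1))) \<in> o(\<lambda>n. 1 - p n)"
    then show "(\<lambda>n. run_prob k n (p n)) \<longlonglongrightarrow> 1"
      by (intro run_prob_tendsto_1_between[OF assms(4) p]) auto
  next
    assume "(\<lambda>n. 1 - p n) \<sim>[sequentially] (\<lambda>n. \<alpha> * real n powr (- 1 / real (k - 1)))"
    then show "(\<lambda>n. run_prob k n (p n)) \<longlonglongrightarrow> 1 - exp (- (\<alpha> ^ (k - 1) / real k))"
      using assms(5) by (intro run_prob_tendsto_small_q[OF assms(4) p] asymp_equiv_imp_ratio) auto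
  next
    assume "(\<lambda>n. 1 - p n) \<in> o(\<lambda>n. real n powr (- 1 / real (k - 1)))"
    from run_prob_tendsto_small_q[OF assms(4) p smalloD_tendsto[OF this]] k(2)
    show "(\<lambda>n. run_prob k n (p n)) \<longlonglongrightarrow> 0" by (simp add: power_0_left)
  qed
qed

end
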